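(* If $2\leq k<\ell$, $\tau\in\mathbb E_k$, and $m=|\tau|$, then $\uparrow^{\ell}_{k}m\geq|\uparrow^{\ell}\tau|$.
   Context: For $k\ge2$, $\mathbb E_k$ is the set of base $k$ terms of the exponential notation system $\mathcal E$: the least set containing the constant $0$ and closed under $\sigma,\tau\mapsto\sigma+\tau$ and $\tau\mapsto k^\tau$ (base-$k$ exponentiation is a unary operation). Terms are treated modulo associativity of $+$. The value $|\tau|\in\mathbb N$ is the natural number obtained by evaluating the term. Normal forms: $\mathrm{nf}_k(0)=0$; for $n>0$, let $r$ be the unique natural number with $k^r\le n<k^{r+1}$ and $b=n-k^r$, and set $\mathrm{nf}_k(n)=k^{\mathrm{nf}_k(r)}+\mathrm{nf}_k(b)$ (a summand $\mathrm{nf}_k(b)=0$ is omitted). For $\tau\in\mathbb E_k$, the base change $\uparrow^\ell\tau\in\mathbb E_\ell$ is defined by $\uparrow^\ell0=0$, $\uparrow^\ell(\sigma+\tau)=\uparrow^\ell\sigma+\uparrow^\ell\tau$, $\uparrow^\ell(k^\tau)=\ell^{\uparrow^\ell\tau}$. For $m\in\mathbb N$, $\uparrow^\ell_km=|\uparrow^\ell\mathrm{nf}_k(m)|$. *)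

theory Defs
  imports Main
begin

text \<open>Raw terms over the constant \<open>0\<close>, binary addition and the unary operations \<open>t \<mapsto> k^t\<close>, one
  for each base \<open>k\<close>. Terms proper are raw terms modulo associativity of addition.\<close>

datatype raw_term = RZero | RPlus raw_term raw_term | RPow nat raw_term

inductive assoc_eq :: "raw_term \<Rightarrow> raw_term \<Rightarrow> bool" where
  assoc: "assoc_eq (RPlus (RPlus r s) t) (RPlus r (RPlus s t))"
| plus: "assoc_eq s s' \<Longrightarrow> assoc_eq t t' \<Longrightarrow> assoc_eq (RPlus s t) (RPlus s' t')"
| pow: "assoc_eq t t' \<Longrightarrow> assoc_eq (RPow k t) (RPow k t')"
| refl: "assoc_eq t t"
| sym: "assoc_eq s t \<Longrightarrow> assoc_eq t s"
| trans: "assoc_eq r s \<Longrightarrow> assoc_eq s t \<Longrightarrow> assoc_eq r t"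

quotient_type eterm = raw_term / assoc_eq
  by (rule equivpI) (auto intro!: reflpI sympI transpI intro: assoc_eq.refl assoc_eq.sym assoc_eq.trans)

lift_definition EZero :: eterm is RZero .
lift_definition EPlus :: "eterm \<Rightarrow> eterm \<Rightarrow> eterm" is RPlus by (rule assoc_eq.plus)
lift_definition EPow :: "nat \<Rightarrow> eterm \<Rightarrow> eterm" is RPow by (rule assoc_eq.pow)

lemma EPlus_assoc: "EPlus (EPlus r s) t = EPlus r (EPlus s t)"
  by transfer (rule assoc_eq.assoc)

lemma eterm_induct [case_names EZero EPlus EPow, induct type: eterm]:
  assumes "P EZero"
    and "\<And>s t. P s \<Longrightarrow> P t \<Longrightarrow> P (EPlus s t)"
    and "\<And>k t. P t \<Longrightarrow> P (EPow k t)"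
  shows "P t"
proof -
  have "P (abs_eterm r)" for r
    by (induction r) (use assms in \<open>simp_all add: EZero_def EPlus.abs_eq[symmetric] EPow.abs_eq[symmetric]\<close>)
  then show ?thesis
    by (metis Quotient_abs_rep Quotient_eterm)
qed

inductive_set terms :: "nat \<Rightarrow> eterm set" for k :: nat where
  Zero: "EZero \<in> terms k"
| Plus: "s \<in> terms k \<Longrightarrow> t \<in> terms k \<Longrightarrow> EPlus s t \<in> terms k"
| Pow: "t \<in> terms k \<Longrightarrow> EPow k t \<in> terms k"

primrec raw_val :: "raw_term \<Rightarrow> nat" where
  "raw_val RZero = 0"
| "raw_val (RPlus s t) = raw_val s + raw_val t"
| "raw_val (RPow k t) = k ^ raw_val t"

lift_definition val :: "eterm \<Rightarrow> nat" is raw_val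
proof -
  fix s t assume "assoc_eq s t"
  then show "raw_val s = raw_val t" by induction simp_all
qed

lemma val_simps [simp]:
  "val EZero = 0"
  "val (EPlus s t) = val s + val t"
  "val (EPow k t) = k ^ val t"
  by (transfer, simp)+

primrec raw_base_change :: "nat \<Rightarrow> raw_term \<Rightarrow> raw_term" where
  "raw_base_change l RZero = RZero"
| "raw_base_change l (RPlus s t) = RPlus (raw_base_change l s) (raw_base_change l t)"
| "raw_base_change l (RPow k t) = RPow l (raw_base_change l t)"

lift_definition base_change :: "nat \<Rightarrow> eterm \<Rightarrow> eterm" is raw_base_change
proof -
  fix l s t assume "assoc_eq s t"
  then show "assoc_eq (raw_base_change l s) (raw_base_change l t)"
    by induction (auto intro: assoc_eq.intros)
qed

lemma base_change_simps [simp]: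
  "base_change l EZero = EZero"
  "base_change l (EPlus s t) = EPlus (base_change l s) (base_change l t)"
  "base_change l (EPow k t) = EPow l (base_change l t)"
  by (transfer, simp add: assoc_eq.refl)+

lemma base_change_terms: "t \<in> terms k \<Longrightarrow> base_change l t \<in> terms l"
  by (induction rule: terms.induct) (auto intro: terms.intros)

definition lead_exp :: "nat \<Rightarrow> nat \<Rightarrow> nat" where
  "lead_exp k n = (THE r. k ^ r \<le> n \<and> n < k ^ Suc r)"

lemma ex1_lead_exp:
  fixes k n :: nat
  assumes "2 \<le> k" "0 < n"
  shows "\<exists>!r. k ^ r \<le> n \<and> n < k ^ Suc r"
proof (rule ex_ex1I)
  show "\<exists>r. k ^ r \<le> n \<and> n < k ^ Suc r"
    using ex_power_ivl1[of k n] assms by simp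
next
  fix r s
  assume r: "k ^ r \<le> n \<and> n < k ^ Suc r" and s: "k ^ s \<le> n \<and> n < k ^ Suc s"
  have "k ^ r < k ^ Suc s" "k ^ s < k ^ Suc r" using r s by linarith+
  then have "r < Suc s" "s < Suc r" using assms by (metis power_less_imp_less_exp One_nat_def Suc_1 Suc_le_lessD)+
  then show "r = s" by simp
qed

lemma lead_exp:
  assumes "2 \<le> k" "0 < n"
  shows "k ^ lead_exp k n \<le> n" "n < k ^ Suc (lead_exp k n)"
  using theI'[OF ex1_lead_exp[OF assms]] unfolding lead_exp_def by auto

text \<open>The junk value for \<open>k < 2\<close> only serves to make the function total.
  As \<open>0\<close> is not neutral for addition of terms, the summand for \<open>b = 0\<close> is dropped explicitly.\<close>

function nf :: "nat \<Rightarrow> nat \<Rightarrow> eterm" where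
  "nf k n =
    (if n = 0 \<or> k < 2 then EZero
     else let r = lead_exp k n; b = n - k ^ r
          in if b = 0 then EPow k (nf k r) else EPlus (EPow k (nf k r)) (nf k b))"
  by pat_completeness auto
termination
proof -
  have less: "lead_exp k n < n" if "\<not> (n = 0 \<or> k < 2)" for k n :: nat
  proof -
    have "lead_exp k n < k ^ lead_exp k n" using that by (simp add: power_gt_expt)
    also have "\<dots> \<le> n" using lead_exp(1)[of k n] that by simp
    finally show ?thesis .
  qed
  show ?thesis by (relation "measure snd") (auto simp: less)
qed

declare nf.simps [simp del]

lemma nf_terms: "nf k n \<in> terms k"
  by (induction k n rule: nf.induct) (subst nf.simps, simp add: Let_def terms.intros)

lemma val_nf: "2 \<le> k \<Longrightarrow> val (nf k n) = n"
proof (induction k n rule: nf.induct)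
  case (1 k n)
  show ?case
  proof (cases "n = 0")
    case False
    then have "k ^ lead_exp k n \<le> n" using lead_exp 1 by simp
    then show ?thesis using 1 False by (subst nf.simps) (auto simp: Let_def)
  qed (simp add: nf.simps)
qed

definition base_change_nat :: "nat \<Rightarrow> nat \<Rightarrow> nat \<Rightarrow> nat" where
  "base_change_nat k l m = val (base_change l (nf k m))"

end

theory Submission
  imports Defs
begin

text \<open>
  Write \<open>F\<close> for \<open>base_change_nat k l\<close>. Unfolding normal forms, \<open>F n\<close> is the base \<open>k\<close>
  expansion of \<open>n\<close> in which each power \<open>k ^ i\<close> is replaced by the weight \<open>l ^ F i\<close>
  (\<open>base_change_nat_eq_weighted_digit_sum\<close>); in particular \<open>F (k ^ r) = l ^ F r\<close>. The heart of
  the matter is that \<open>F\<close> is superadditive. Adding two base \<open>k\<close> expansions changes the weighted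
  digit sum only at carries, where \<open>k\<close> copies of the weight at position \<open>i\<close> become one
  copy of the weight at position \<open>i + 1\<close>. This is no loss as soon as each weight is at least
  \<open>k\<close> times its predecessor (\<open>weighted_digit_sum_superadditive\<close>), which for the weights
  \<open>l ^ F i\<close> follows from \<open>F i < F (i + 1)\<close> and \<open>k \<le> l\<close>.

  Strict monotonicity of \<open>F\<close> is itself superadditivity with one summand equal to \<open>1\<close>. There
  is no circle, since a sum \<open>n\<close> only produces carries into positions \<open>i + 1\<close> with
  \<open>k ^ (i + 1) \<le> n\<close>, and these are smaller than \<open>n\<close>. So monotonicity is obtained by
  strong induction.

  The theorem is then an induction on the term: at a sum, superadditivity is used, and at a
  power, the equation \<open>F (k ^ r) = l ^ F r\<close>. In other words, among all terms of a given value
  the normal form has the largest base change, because it has all carries carried out.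
\<close>

text \<open>The case \<open>k < 2\<close> is excluded so that the recursion on \<open>n div k\<close> terminates.\<close>

fun weighted_digit_sum :: "nat \<Rightarrow> (nat \<Rightarrow> nat) \<Rightarrow> nat \<Rightarrow> nat" where
  "weighted_digit_sum k w n =
    (if n = 0 \<or> k < 2 then 0
     else n mod k * w 0 + weighted_digit_sum k (\<lambda>i. w (Suc i)) (n div k))"

declare weighted_digit_sum.simps [simp del]

lemma weighted_digit_sum_0 [simp]: "weighted_digit_sum k w 0 = 0"
  by (simp add: weighted_digit_sum.simps)

lemma weighted_digit_sum_rec:
  "2 \<le> k \<Longrightarrow> weighted_digit_sum k w n
     = n mod k * w 0 + weighted_digit_sum k (\<lambda>i. w (Suc i)) (n div k)"
  by (cases "n = 0") (simp_all add: weighted_digit_sum.simps[of k w n])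

lemma weighted_digit_sum_less_base:
  "2 \<le> k \<Longrightarrow> n < k \<Longrightarrow> weighted_digit_sum k w n = n * w 0"
  by (simp add: weighted_digit_sum_rec[of k w n])

text \<open>The bound says that incrementing the digit at position \<open>r\<close> causes no carry.\<close>

lemma weighted_digit_sum_add_power:
  assumes "2 \<le> k" "n + k ^ r < k ^ Suc r"
  shows "weighted_digit_sum k w (n + k ^ r) = w r + weighted_digit_sum k w n"
  using assms(2)
proof (induction r arbitrary: n w)
  case 0
  then show ?case using assms(1) by (simp add: weighted_digit_sum_less_base)
next
  case (Suc r)
  have "(n + k ^ Suc r) div k < k ^ Suc r"
    using Suc.prems assms(1) by (intro less_mult_imp_div_less) (simp add: mult.commute)
  then have "n div k + k ^ r < k ^ Suc r"
    using assms(1) by simp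
  then show ?case
    using Suc.IH[of "n div k" "\<lambda>i. w (Suc i)"] assms(1)
    by (simp add: weighted_digit_sum_rec[of k w "n + k * k ^ r"] weighted_digit_sum_rec[of k w n] add.commute)
qed

lemma weighted_digit_sum_power:
  "2 \<le> k \<Longrightarrow> weighted_digit_sum k w (k ^ r) = w r"
  using weighted_digit_sum_add_power[of k 0 r w] by simp

text \<open>
  Schoolbook addition, from the lowest digit upwards: a carry out of position \<open>0\<close> removes
  \<open>k * w 0\<close> and adds \<open>1\<close> to the remaining sum. The growth of the weights is only demanded at
  the positions into which a carry can occur, because in the application to base change larger
  positions are not yet under control.
\<close>

lemma weighted_digit_sum_superadditive:
  assumes "2 \<le> k"
    and "\<And>i. k ^ Suc i \<le> m + n \<Longrightarrow> k * w i \<le> w (Suc i)"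
  shows "weighted_digit_sum k w m + weighted_digit_sum k w n \<le> weighted_digit_sum k w (m + n)"
  using assms(2)
proof (induction "m + n" arbitrary: m n w rule: less_induct)
  case less
  let ?w = "\<lambda>i. w (Suc i)"
  let ?D = "weighted_digit_sum k ?w"
  let ?a = "m div k" and ?b = "n div k" and ?c = "m mod k + n mod k"
  show ?case
  proof (cases "m + n = 0")
    case False
    then have div_less: "(m + n) div k < m + n"
      using assms(1) by (intro div_less_dividend) auto
    have high: "?D x + ?D y \<le> ?D (x + y)" if "x + y \<le> (m + n) div k" for x y
    proof (rule less.hyps)
      show "x + y < m + n" using that div_less by linarith
      fix i assume "k ^ Suc i \<le> x + y"
      with that have "k ^ Suc i \<le> (m + n) div k" by linarith
      then have "k ^ Suc (Suc i) \<le> m + n"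
        using assms(1) by (simp add: less_eq_div_iff_mult_less_eq mult.commute)
      then show "k * ?w i \<le> ?w (Suc i)" by (rule less.prems)
    qed
    have split: "m + n = k * (?a + ?b) + ?c"
      by (simp add: algebra_simps)
    show ?thesis
    proof (cases "?c < k")
      case True
      then have "(m + n) div k = ?a + ?b" "(m + n) mod k = ?c"
        using assms(1) by (subst split, simp)+
      with high[of ?a ?b] show ?thesis
        using assms(1) by (simp add: weighted_digit_sum_rec[of k w] algebra_simps)
    next
      case False
      have "?c < 2 * k"
        using assms(1) mod_less_divisor[of k m] mod_less_divisor[of k n] by linarith
      with False have "m + n = k * (?a + ?b + 1) + (?c - k)" and lt: "?c - k < k"
        using split add_mult_distrib2[of k "?a + ?b" 1] by linarith+
      moreover have "(k * q + d) div k = q" "(k * q + d) mod k = d" if "d < k" for q d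
        using that by simp_all
      ultimately have carry: "(m + n) div k = ?a + ?b + 1" "(m + n) mod k = ?c - k"
        by metis+
      have "k * 1 \<le> m + n"
        using False split by linarith
      then have "k * w 0 \<le> w (Suc 0)"
        by (intro less.prems) simp
      also have "\<dots> = ?D 1"
        using assms(1) by (simp add: weighted_digit_sum_less_base)
      finally have w: "k * w 0 \<le> ?D 1" .
      have "?D ?a + ?D ?b + ?D 1 \<le> ?D (?a + ?b + 1)"
        using high[of ?a ?b] high[of "?a + ?b" 1] carry by linarith
      moreover have "(?c - k) * w 0 + k * w 0 = ?c * w 0"
        using False by (simp flip: add_mult_distrib)
      ultimately show ?thesis
        using w carry assms(1) by (simp add: weighted_digit_sum_rec[of k w] algebra_simps)
    qed
  qed simp
qed

lemma base_change_nat_0 [simp]: "base_change_nat k l 0 = 0"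
  by (simp add: base_change_nat_def nf.simps)

lemma base_change_nat_rec:
  assumes "2 \<le> k" "0 < n"
  shows "base_change_nat k l n
    = l ^ base_change_nat k l (lead_exp k n) + base_change_nat k l (n - k ^ lead_exp k n)"
  using assms by (simp add: base_change_nat_def nf.simps[of k n] nf.simps[of k 0] Let_def)

lemma base_change_nat_eq_weighted_digit_sum:
  assumes "2 \<le> k"
  shows "base_change_nat k l n = weighted_digit_sum k (\<lambda>i. l ^ base_change_nat k l i) n"
proof (induction n rule: less_induct)
  case (less n)
  show ?case
  proof (cases "n = 0")
    case False
    let ?r = "lead_exp k n"
    have r: "k ^ ?r \<le> n" "n < k ^ Suc ?r"
      using lead_exp[of k n] assms False by auto
    have "n - k ^ ?r < n"
      using assms False by simp
    then show ?thesis
      using weighted_digit_sum_add_power[of k "n - k ^ ?r" ?r "\<lambda>i. l ^ base_change_nat k l i"]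
        r assms False less by (simp add: base_change_nat_rec)
  qed simp
qed

lemma base_change_nat_power:
  "2 \<le> k \<Longrightarrow> base_change_nat k l (k ^ r) = l ^ base_change_nat k l r"
  by (simp add: base_change_nat_eq_weighted_digit_sum[of k l "k ^ r"] weighted_digit_sum_power)

lemma base_change_nat_1: "2 \<le> k \<Longrightarrow> base_change_nat k l 1 = 1"
  using base_change_nat_power[of k l 0] by simp

text \<open>
  The bridge between the two uses of the digit sum: growth of \<open>F\<close> at the exponents that occur
  in carries makes the weights \<open>l ^ F i\<close> grow by a factor \<open>l \<ge> k\<close>.
\<close>

lemma base_change_nat_superadditive_aux:
  assumes "2 \<le> k" "k \<le> l"
    and "\<And>i. k ^ Suc i \<le> m + n \<Longrightarrow> base_change_nat k l i < base_change_nat k l (Suc i)"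
  shows "base_change_nat k l m + base_change_nat k l n \<le> base_change_nat k l (m + n)"
proof -
  let ?F = "base_change_nat k l"
  have "k * l ^ ?F i \<le> l ^ ?F (Suc i)" if "k ^ Suc i \<le> m + n" for i
  proof -
    have "k * l ^ ?F i \<le> l ^ Suc (?F i)"
      using assms(2) by simp
    also have "\<dots> \<le> l ^ ?F (Suc i)"
      using assms that by (intro power_increasing) (auto simp: Suc_le_eq)
    finally show ?thesis .
  qed
  then have "weighted_digit_sum k (\<lambda>i. l ^ ?F i) m + weighted_digit_sum k (\<lambda>i. l ^ ?F i) n
      \<le> weighted_digit_sum k (\<lambda>i. l ^ ?F i) (m + n)"
    by (rule weighted_digit_sum_superadditive[OF assms(1)])
  then show ?thesis
    by (simp flip: base_change_nat_eq_weighted_digit_sum[OF assms(1)])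
qed

text \<open>
  Comparing the values at \<open>n\<close> and \<open>n + 1\<close> only involves carries into positions \<open>i + 1\<close> with
  \<open>i + 1 < k ^ (i + 1) \<le> n + 1\<close>, so the induction hypothesis covers them.
\<close>

lemma base_change_nat_less_Suc:
  assumes "2 \<le> k" "k \<le> l"
  shows "base_change_nat k l n < base_change_nat k l (Suc n)"
proof (induction n rule: less_induct)
  case (less n)
  have "base_change_nat k l n + base_change_nat k l 1 \<le> base_change_nat k l (n + 1)"
  proof (rule base_change_nat_superadditive_aux[OF assms])
    fix i assume "k ^ Suc i \<le> n + 1"
    moreover have "Suc i < k ^ Suc i"
      using assms(1) by (intro power_gt_expt) simp
    ultimately show "base_change_nat k l i < base_change_nat k l (Suc i)"
      by (intro less.IH) linarith
  qed
  then show ?case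
    using base_change_nat_1[OF assms(1), of l] by simp
qed

lemma base_change_nat_superadditive:
  assumes "2 \<le> k" "k \<le> l"
  shows "base_change_nat k l m + base_change_nat k l n \<le> base_change_nat k l (m + n)"
  using assms base_change_nat_less_Suc by (intro base_change_nat_superadditive_aux)

theorem theorem5p6:
  fixes k l m :: nat and \<tau> :: eterm
  assumes "2 \<le> k" and "k < l"
    and "\<tau> \<in> terms k"
    and "m = val \<tau>"
  shows "base_change_nat k l m \<ge> val (base_change l \<tau>)"
proof -
  from \<open>\<tau> \<in> terms k\<close> have "val (base_change l \<tau>) \<le> base_change_nat k l (val \<tau>)"
  proof induction
    case (Plus s t)
    then show ?case
      using base_change_nat_superadditive[of k l "val s" "val t"] assms(1,2) by simp
  next
    case (Pow t)
    then show ?case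
      using assms(1,2) by (simp add: base_change_nat_power power_increasing)
  qed simp
  then show ?thesis
    using assms(4) by simp
qed

end
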